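(* Every automorphism $\alpha\in\mathrm{Aut}(\mathcal{Q}_2)$ such that $\alpha(U)=U^*$ is an outer automorphism.
   Context: The $2$-adic ring $C^*$-algebra $\mathcal{Q}_2$ is the universal (unital) $C^*$-algebra generated by a unitary $U$ and an isometry $S_2$ satisfying $S_2U=U^2S_2$ and $S_2S_2^*+US_2S_2^*U^*=1$. An automorphism is outer if it is not of the form $x\mapsto wxw^*$ for a unitary $w\in\mathcal{Q}_2$. *)

theory Defs
  imports "HOL-Analysis.Analysis" "HOL-Algebra.Algebraic_Closure_Type"
begin

section \<open>Unital C*-algebras\<close>

text \<open>
  Unital C*-algebras are structures with an explicit carrier, extending the modules of HOL-Algebra,
  because the universal property below quantifies over C*-algebras. The scalar ring
  \<^term>\<open>ring_of_type_algebra :: complex ring\<close> is the field of complex numbers with its type class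
  operations. As usual, the zero algebra counts as a unital C*-algebra.
\<close>

record 'a cstar = "(complex, 'a) module" +
  star :: "'a \<Rightarrow> 'a"
  cnorm :: "'a \<Rightarrow> real"

locale cstar_algebra =
  module "ring_of_type_algebra :: complex ring" A + ring A for A :: "'a cstar" (structure) +
  assumes smult_mult_left:
      "\<lbrakk>x \<in> carrier A; y \<in> carrier A\<rbrakk> \<Longrightarrow> (c \<odot> x) \<otimes> y = c \<odot> (x \<otimes> y)"
    and smult_mult_right:
      "\<lbrakk>x \<in> carrier A; y \<in> carrier A\<rbrakk> \<Longrightarrow> x \<otimes> (c \<odot> y) = c \<odot> (x \<otimes> y)"
    and star_closed: "x \<in> carrier A \<Longrightarrow> star A x \<in> carrier A"
    and star_star: "x \<in> carrier A \<Longrightarrow> star A (star A x) = x"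
    and star_add:
      "\<lbrakk>x \<in> carrier A; y \<in> carrier A\<rbrakk> \<Longrightarrow> star A (x \<oplus> y) = star A x \<oplus> star A y"
    and star_mult:
      "\<lbrakk>x \<in> carrier A; y \<in> carrier A\<rbrakk> \<Longrightarrow> star A (x \<otimes> y) = star A y \<otimes> star A x"
    and star_smult: "x \<in> carrier A \<Longrightarrow> star A (c \<odot> x) = cnj c \<odot> star A x"
    and cnorm_nonneg: "x \<in> carrier A \<Longrightarrow> 0 \<le> cnorm A x"
    and cnorm_eq_0: "x \<in> carrier A \<Longrightarrow> cnorm A x = 0 \<longleftrightarrow> x = \<zero>"
    and cnorm_triangle:
      "\<lbrakk>x \<in> carrier A; y \<in> carrier A\<rbrakk> \<Longrightarrow> cnorm A (x \<oplus> y) \<le> cnorm A x + cnorm A y"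
    and cnorm_smult: "x \<in> carrier A \<Longrightarrow> cnorm A (c \<odot> x) = cmod c * cnorm A x"
    and cnorm_mult:
      "\<lbrakk>x \<in> carrier A; y \<in> carrier A\<rbrakk> \<Longrightarrow> cnorm A (x \<otimes> y) \<le> cnorm A x * cnorm A y"
    and cstar_identity: "x \<in> carrier A \<Longrightarrow> cnorm A (star A x \<otimes> x) = (cnorm A x)\<^sup>2"
    and complete:
      "\<lbrakk>\<And>n :: nat. f n \<in> carrier A;
        \<And>e. e > 0 \<Longrightarrow> \<exists>N. \<forall>m\<ge>N. \<forall>n\<ge>N. cnorm A (f m \<ominus> f n) < e\<rbrakk>
       \<Longrightarrow> \<exists>x\<in>carrier A. (\<lambda>n. cnorm A (f n \<ominus> x)) \<longlonglongrightarrow> 0"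

definition isometry_in :: "'a cstar \<Rightarrow> 'a \<Rightarrow> bool" where
  "isometry_in A s \<longleftrightarrow> s \<in> carrier A \<and> star A s \<otimes>\<^bsub>A\<^esub> s = \<one>\<^bsub>A\<^esub>"

definition unitary_in :: "'a cstar \<Rightarrow> 'a \<Rightarrow> bool" where
  "unitary_in A u \<longleftrightarrow>
     u \<in> carrier A \<and> star A u \<otimes>\<^bsub>A\<^esub> u = \<one>\<^bsub>A\<^esub> \<and> u \<otimes>\<^bsub>A\<^esub> star A u = \<one>\<^bsub>A\<^esub>"

text \<open>Homomorphisms are unital (by \<^const>\<open>ring_hom\<close>); values outside the carrier are irrelevant.\<close>

definition star_hom :: "'a cstar \<Rightarrow> 'b cstar \<Rightarrow> ('a \<Rightarrow> 'b) \<Rightarrow> bool" where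
  "star_hom A B \<phi> \<longleftrightarrow>
     \<phi> \<in> ring_hom A B \<and>
     (\<forall>c. \<forall>x\<in>carrier A. \<phi> (c \<odot>\<^bsub>A\<^esub> x) = c \<odot>\<^bsub>B\<^esub> \<phi> x) \<and>
     (\<forall>x\<in>carrier A. \<phi> (star A x) = star B (\<phi> x))"

definition star_automorphism :: "'a cstar \<Rightarrow> ('a \<Rightarrow> 'a) \<Rightarrow> bool" where
  "star_automorphism A \<alpha> \<longleftrightarrow> star_hom A A \<alpha> \<and> bij_betw \<alpha> (carrier A) (carrier A)"

definition inner_automorphism :: "'a cstar \<Rightarrow> ('a \<Rightarrow> 'a) \<Rightarrow> bool" where
  "inner_automorphism A \<alpha> \<longleftrightarrow>
     star_automorphism A \<alpha> \<and>
     (\<exists>w. unitary_in A w \<and> (\<forall>x\<in>carrier A. \<alpha> x = w \<otimes>\<^bsub>A\<^esub> x \<otimes>\<^bsub>A\<^esub> star A w))"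

definition outer_automorphism :: "'a cstar \<Rightarrow> ('a \<Rightarrow> 'a) \<Rightarrow> bool" where
  "outer_automorphism A \<alpha> \<longleftrightarrow> star_automorphism A \<alpha> \<and> \<not> inner_automorphism A \<alpha>"

definition cstar_subalgebra :: "'a set \<Rightarrow> 'a cstar \<Rightarrow> bool" where
  "cstar_subalgebra B A \<longleftrightarrow>
     B \<subseteq> carrier A \<and> \<one>\<^bsub>A\<^esub> \<in> B \<and>
     (\<forall>x\<in>B. \<forall>y\<in>B. x \<oplus>\<^bsub>A\<^esub> y \<in> B \<and> x \<otimes>\<^bsub>A\<^esub> y \<in> B) \<and>
     (\<forall>c. \<forall>x\<in>B. c \<odot>\<^bsub>A\<^esub> x \<in> B) \<and>
     (\<forall>x\<in>B. star A x \<in> B) \<and>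
     (\<forall>f x. (\<forall>n :: nat. f n \<in> B) \<and> x \<in> carrier A \<and> (\<lambda>n. cnorm A (f n \<ominus>\<^bsub>A\<^esub> x)) \<longlonglongrightarrow> 0
        \<longrightarrow> x \<in> B)"

definition cstar_generated_by :: "'a cstar \<Rightarrow> 'a set \<Rightarrow> bool" where
  "cstar_generated_by A G \<longleftrightarrow>
     G \<subseteq> carrier A \<and> (\<forall>B. cstar_subalgebra B A \<and> G \<subseteq> B \<longrightarrow> B = carrier A)"

section \<open>The 2-adic ring C*-algebra\<close>

definition Q2_relations :: "'a cstar \<Rightarrow> 'a \<Rightarrow> 'a \<Rightarrow> bool" where
  "Q2_relations A u s \<longleftrightarrow>
     unitary_in A u \<and> isometry_in A s \<and>
     s \<otimes>\<^bsub>A\<^esub> u = (u [^]\<^bsub>A\<^esub> (2::nat)) \<otimes>\<^bsub>A\<^esub> s \<and>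
     (s \<otimes>\<^bsub>A\<^esub> star A s) \<oplus>\<^bsub>A\<^esub> (u \<otimes>\<^bsub>A\<^esub> s \<otimes>\<^bsub>A\<^esub> star A s \<otimes>\<^bsub>A\<^esub> star A u) = \<one>\<^bsub>A\<^esub>"

text \<open>
  The algebras tested in a universal property must have their carriers in some fixed type. A
  C*-algebra generated by two elements is separable, hence faithfully represented on the Hilbert
  space of square-summable functions on the integers, and so isomorphic to one whose elements are
  (operators extended to) maps from \<^typ>\<open>int \<Rightarrow> complex\<close> to itself. Testing against the
  C*-algebras carried by the following type, with arbitrary operations and norm, is therefore
  equivalent to testing against all C*-algebras.
\<close>

type_synonym test_carrier = "(int \<Rightarrow> complex) \<Rightarrow> (int \<Rightarrow> complex)"

text \<open>
  The homomorphism \<open>\<phi>\<close> below is unique on the carrier of \<open>A\<close>, since \<open>A\<close> is generated by \<open>U\<close> and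
  \<open>S\<^sub>2\<close> and *-homomorphisms between C*-algebras are continuous. The algebra is determined by this
  definition up to an isomorphism preserving the two generators.
\<close>

definition is_Q2 :: "'a cstar \<Rightarrow> 'a \<Rightarrow> 'a \<Rightarrow> bool" where
  "is_Q2 A U S\<^sub>2 \<longleftrightarrow>
     cstar_algebra A \<and> Q2_relations A U S\<^sub>2 \<and> cstar_generated_by A {U, S\<^sub>2} \<and>
     (\<forall>(B :: test_carrier cstar) u s. cstar_algebra B \<and> Q2_relations B u s \<longrightarrow>
        (\<exists>\<phi>. star_hom A B \<phi> \<and> \<phi> U = u \<and> \<phi> S\<^sub>2 = s))"

end

theory Submission
  imports Defs
begin

text \<open>
  Suppose that the automorphism is implemented by a unitary \<open>w\<close>, so that \<open>w U = U\<^sup>* w\<close>. The algebra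
  \<open>\<Q>\<^sub>2\<close> acts on the square-summable functions on the integers by \<open>U e\<^sub>k = e\<^sub>k\<^sub>+\<^sub>1\<close> and \<open>S\<^sub>2 e\<^sub>k = e\<^sub>2\<^sub>k\<close>.
  In this representation the relation says that the matrix of \<open>w\<close> is constant along the
  antidiagonals, like that of the reflection \<open>e\<^sub>k \<mapsto> e\<^sub>-\<^sub>k\<close>; in particular, the coefficient of
  \<open>w e\<^sub>-\<^sub>n\<close> at \<open>d + n\<close> does not depend on \<open>n\<close>. On the other hand, \<open>U\<close>, \<open>S\<^sub>2\<close> and their adjoints map
  basis vectors to basis vectors or to zero by rules with positive slope, so they never carry vectors
  far to the left to vectors with mass elsewhere. This property passes to sums, products and norm
  limits, hence to all of \<open>\<Q>\<^sub>2\<close>. Therefore the coefficient of \<open>w e\<^sub>-\<^sub>n\<close> at \<open>d + n\<close> tends to \<open>0\<close>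
  as \<open>n\<close> grows; being constant in \<open>n\<close>, it vanishes, and \<open>w e\<^sub>0 = 0\<close> contradicts the
  unitarity of \<open>w\<close>.

  To make ``far to the left'' stable under composition, call a bounded sequence of vectors escaping
  if, for every \<open>k\<close>, its restrictions to the coordinates \<open>\<ge> k\<close> tend to \<open>0\<close>. The operators that,
  together with their adjoints, map escaping sequences to escaping sequences form a norm-closed
  *-algebra \<open>directed_operators\<close>. This C*-algebra, instead of all bounded operators, is the one
  that the universal property is tested against (\<open>Q2_relations_test_algebra\<close>), so that
  the image of \<open>w\<close> has the property by construction. The contradiction is
  \<open>preserves_escaping_no_reflection\<close>.

  Most of the work is to provide the Hilbert space, as a real inner product space with an operator
  of multiplication by \<open>\<i>\<close>, and to see that norm-closed *-algebras of operators satisfy the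
  axioms of C*-algebras (\<open>cstar_algebra_to_cstar\<close>).
\<close>

section \<open>The Hilbert space of square-summable functions\<close>

lemma summable_on_inner:
  fixes x y :: "'i \<Rightarrow> complex"
  assumes "(\<lambda>i. (cmod (x i))\<^sup>2) summable_on I" and "(\<lambda>i. (cmod (y i))\<^sup>2) summable_on I"
  shows "(\<lambda>i. x i \<bullet> y i) summable_on I"
proof -
  have "norm (x i \<bullet> y i) \<le> (cmod (x i))\<^sup>2 + (cmod (y i))\<^sup>2" for i
  proof -
    have "\<bar>x i \<bullet> y i\<bar> \<le> cmod (x i) * cmod (y i)"
      by (rule Cauchy_Schwarz_ineq2)
    also have "\<dots> \<le> (cmod (x i))\<^sup>2 + (cmod (y i))\<^sup>2"
      using sum_squares_bound[of "cmod (x i)" "cmod (y i)"]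
        mult_nonneg_nonneg[OF norm_ge_zero[of "x i"] norm_ge_zero[of "y i"]]
      by linarith
    finally show ?thesis
      by simp
  qed
  with summable_on_add[OF assms] have "(\<lambda>i. norm (x i \<bullet> y i)) summable_on I"
    by (rule Infinite_Sum.abs_summable_on_comparison_test')
  then show ?thesis
    by (rule abs_summable_summable)
qed

typedef 'i ell2 = "{x :: 'i \<Rightarrow> complex. (\<lambda>i. (cmod (x i))\<^sup>2) summable_on UNIV}"
  morphisms coord Ell2
  by (rule exI[of _ "\<lambda>_. 0"]) simp

setup_lifting type_definition_ell2

lemma ell2_eqI: "(\<And>i. coord x i = coord y i) \<Longrightarrow> x = y"
  by (metis coord_inject ext)

lemma coord_summable: "(\<lambda>i. (cmod (coord x i))\<^sup>2) summable_on UNIV"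
  using coord[of x] by simp

text \<open>
  The inner product is the real part of the usual Hermitian one. This makes the real theory of
  bounded linear operators available and loses nothing: an operator that commutes with
  multiplication by \<open>\<i>\<close> has the same adjoint for the real and for the Hermitian inner product.
\<close>

instantiation ell2 :: (type) real_inner
begin

lift_definition zero_ell2 :: "'a ell2" is "\<lambda>_. 0"
  by simp

lift_definition plus_ell2 :: "'a ell2 \<Rightarrow> 'a ell2 \<Rightarrow> 'a ell2" is "\<lambda>x y i. x i + y i"
proof -
  fix x y :: "'a \<Rightarrow> complex"
  assume xy: "(\<lambda>i. (cmod (x i))\<^sup>2) summable_on UNIV" "(\<lambda>i. (cmod (y i))\<^sup>2) summable_on UNIV"
  have "(\<lambda>i. (cmod (x i))\<^sup>2 + 2 * (x i \<bullet> y i) + (cmod (y i))\<^sup>2) summable_on UNIV"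
    using xy by (intro summable_on_add summable_on_cmult_right summable_on_inner)
  then show "(\<lambda>i. (cmod (x i + y i))\<^sup>2) summable_on UNIV"
    by (simp add: power2_norm_eq_inner inner_add inner_commute algebra_simps)
qed

lift_definition scaleR_ell2 :: "real \<Rightarrow> 'a ell2 \<Rightarrow> 'a ell2" is "\<lambda>r x i. r *\<^sub>R x i"
  by (auto simp: power_mult_distrib intro: summable_on_cmult_right)

lift_definition uminus_ell2 :: "'a ell2 \<Rightarrow> 'a ell2" is "\<lambda>x i. - x i"
  by simp

lift_definition minus_ell2 :: "'a ell2 \<Rightarrow> 'a ell2 \<Rightarrow> 'a ell2" is "\<lambda>x y i. x i - y i"
proof -
  fix x y :: "'a \<Rightarrow> complex"
  assume xy: "(\<lambda>i. (cmod (x i))\<^sup>2) summable_on UNIV" "(\<lambda>i. (cmod (y i))\<^sup>2) summable_on UNIV"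
  have "(\<lambda>i. (cmod (x i))\<^sup>2 + (- 2) * (x i \<bullet> y i) + (cmod (y i))\<^sup>2) summable_on UNIV"
    using xy by (intro summable_on_add summable_on_cmult_right summable_on_inner)
  then show "(\<lambda>i. (cmod (x i - y i))\<^sup>2) summable_on UNIV"
    by (simp add: power2_norm_eq_inner inner_diff inner_commute algebra_simps)
qed

definition "inner x y = (\<Sum>\<^sub>\<infinity>i. coord x i \<bullet> coord y i)" for x y :: "'a ell2"

definition "norm x = sqrt (x \<bullet> x)" for x :: "'a ell2"

definition "dist x y = norm (x - y)" for x y :: "'a ell2"

definition "sgn x = inverse (norm x) *\<^sub>R x" for x :: "'a ell2"

definition "(uniformity :: ('a ell2 \<times> 'a ell2) filter) =
  (INF e\<in>{0 <..}. principal {(x, y). dist x y < e})"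

definition "open (S :: 'a ell2 set) \<longleftrightarrow> (\<forall>x\<in>S. \<forall>\<^sub>F (x', y) in uniformity. x' = x \<longrightarrow> y \<in> S)"

instance
proof
  fix x y z :: "'a ell2" and r s :: real
  show "x + y + z = x + (y + z)" "x + y = y + x" "0 + x = x" "- x + x = 0"
       "r *\<^sub>R (x + y) = r *\<^sub>R x + r *\<^sub>R y" "(r + s) *\<^sub>R x = r *\<^sub>R x + s *\<^sub>R x"
       "r *\<^sub>R s *\<^sub>R x = (r * s) *\<^sub>R x" "1 *\<^sub>R x = x"
    by (auto intro!: ell2_eqI simp: zero_ell2.rep_eq plus_ell2.rep_eq uminus_ell2.rep_eq
        scaleR_ell2.rep_eq algebra_simps)
  show "x - y = x + (- y)"
    by (auto intro!: ell2_eqI simp: plus_ell2.rep_eq uminus_ell2.rep_eq minus_ell2.rep_eq)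
  show "sgn x = inverse (norm x) *\<^sub>R x" "dist x y = norm (x - y)"
    by (simp_all add: sgn_ell2_def dist_ell2_def)
  show "norm x = sqrt (x \<bullet> x)"
    by (simp add: norm_ell2_def)
  show "(uniformity :: ('a ell2 \<times> 'a ell2) filter) = (INF e\<in>{0 <..}. principal {(x, y). dist x y < e})"
    by (simp add: uniformity_ell2_def)
  show "open S \<longleftrightarrow> (\<forall>x\<in>S. \<forall>\<^sub>F (x', y) in uniformity. x' = x \<longrightarrow> y \<in> S)" for S :: "'a ell2 set"
    by (simp add: open_ell2_def)
  show "x \<bullet> y = y \<bullet> x"
    by (simp add: inner_ell2_def inner_commute)
  show "(x + y) \<bullet> z = x \<bullet> z + y \<bullet> z"
    by (simp add: inner_ell2_def plus_ell2.rep_eq inner_add_left infsum_add summable_on_inner coord_summable)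
  show "(r *\<^sub>R x) \<bullet> y = r * (x \<bullet> y)"
    by (simp add: inner_ell2_def scaleR_ell2.rep_eq infsum_cmult_right')
  show "0 \<le> x \<bullet> x"
    by (simp add: inner_ell2_def infsum_nonneg)
  show "x \<bullet> x = 0 \<longleftrightarrow> x = 0"
  proof
    assume "x \<bullet> x = 0"
    then have "coord x i \<bullet> coord x i = 0" for i
      unfolding inner_ell2_def
      by (intro nonneg_infsum_le_0D[of "\<lambda>i. coord x i \<bullet> coord x i" UNIV i])
        (auto simp: summable_on_inner coord_summable)
    then show "x = 0"
      by (intro ell2_eqI) (simp add: zero_ell2.rep_eq)
  qed (simp add: inner_ell2_def zero_ell2.rep_eq)
qed

end

lemma coord_simps [simp]:
  "coord 0 i = 0" "coord (x + y) i = coord x i + coord y i" "coord (- x) i = - coord x i"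
  "coord (x - y) i = coord x i - coord y i" "coord (r *\<^sub>R x) i = r *\<^sub>R coord x i"
  by (simp_all add: zero_ell2.rep_eq plus_ell2.rep_eq uminus_ell2.rep_eq minus_ell2.rep_eq
      scaleR_ell2.rep_eq)

lemma norm_ell2_power2: "(norm x)\<^sup>2 = (\<Sum>\<^sub>\<infinity>i. (cmod (coord x i))\<^sup>2)"
  by (simp add: power2_norm_eq_inner inner_ell2_def)

lemma sum_coord_le: "finite F \<Longrightarrow> (\<Sum>i\<in>F. (cmod (coord x i))\<^sup>2) \<le> (norm x)\<^sup>2"
  unfolding norm_ell2_power2 by (rule finite_sum_le_infsum) (auto simp: coord_summable)

lemma coord_le_norm: "cmod (coord x i) \<le> norm x"
  proof (rule power2_le_imp_le)
  show "(cmod (coord x i))\<^sup>2 \<le> (norm x)\<^sup>2"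
    using sum_coord_le[of "{i}" x] by simp
qed simp

text \<open>
  The tool for constructing vectors and for bounding their norms: it replaces summability by a
  uniform bound on finite partial sums, which survives pointwise limits.
\<close>

lemma ell2_bounded_partial_sums:
  assumes "\<And>F. finite F \<Longrightarrow> (\<Sum>i\<in>F. (cmod (x i))\<^sup>2) \<le> b\<^sup>2" and "0 \<le> b"
  shows "coord (Ell2 x) = x" and "norm (Ell2 x) \<le> b"
proof -
  have "(\<lambda>i. (cmod (x i))\<^sup>2) summable_on UNIV"
    using assms(1) by (intro nonneg_bdd_above_summable_on bdd_aboveI2[where M = "b\<^sup>2"]) auto
  then show *: "coord (Ell2 x) = x"
    by (simp add: Ell2_inverse)
  have "(norm (Ell2 x))\<^sup>2 \<le> b\<^sup>2"
    unfolding norm_ell2_power2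
    by (rule infsum_le_finite_sums) (use coord_summable[of "Ell2 x"] assms in \<open>auto simp: *\<close>)
  then show "norm (Ell2 x) \<le> b"
    using assms(2) by (rule power2_le_imp_le)
qed

instance ell2 :: (type) banach
proof
  fix f :: "nat \<Rightarrow> 'a ell2"
  assume f: "Cauchy f"
  have "Cauchy (\<lambda>n. coord (f n) i)" for i
  proof (rule metric_CauchyI)
    fix e :: real assume "0 < e"
    then obtain N where "\<forall>m\<ge>N. \<forall>n\<ge>N. dist (f m) (f n) < e"
      using f by (auto simp: Cauchy_def)
    moreover have "dist (coord (f m) i) (coord (f n) i) \<le> dist (f m) (f n)" for m n
      using coord_le_norm[of "f m - f n" i] by (simp add: dist_norm)
    ultimately show "\<exists>N. \<forall>m\<ge>N. \<forall>n\<ge>N. dist (coord (f m) i) (coord (f n) i) < e"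
      by (meson order_le_less_trans)
  qed
  then have "\<forall>i. \<exists>l. (\<lambda>n. coord (f n) i) \<longlonglongrightarrow> l"
    by (simp add: Cauchy_convergent_iff convergent_def)
  then obtain x where x: "\<And>i. (\<lambda>n. coord (f n) i) \<longlonglongrightarrow> x i"
    by metis
  have fin: "(\<Sum>i\<in>F. (cmod (coord (f n) i - x i))\<^sup>2) \<le> e\<^sup>2"
    if N: "\<And>m. m \<ge> N \<Longrightarrow> dist (f n) (f m) \<le> e" and "finite F" for n N e F
  proof (rule tendsto_upperbound)
    show "(\<lambda>m. \<Sum>i\<in>F. (cmod (coord (f n) i - coord (f m) i))\<^sup>2)
        \<longlonglongrightarrow> (\<Sum>i\<in>F. (cmod (coord (f n) i - x i))\<^sup>2)"
      by (intro tendsto_intros x)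
    have "(\<Sum>i\<in>F. (cmod (coord (f n) i - coord (f m) i))\<^sup>2) \<le> e\<^sup>2" if "m \<ge> N" for m
    proof -
      have "(\<Sum>i\<in>F. (cmod (coord (f n) i - coord (f m) i))\<^sup>2) \<le> (norm (f n - f m))\<^sup>2"
        using sum_coord_le[OF \<open>finite F\<close>, of "f n - f m"] by simp
      also have "\<dots> \<le> e\<^sup>2"
        using N[OF that] by (simp add: dist_norm power_mono)
      finally show ?thesis .
    qed
    then show "\<forall>\<^sub>F m in sequentially. (\<Sum>i\<in>F. (cmod (coord (f n) i - coord (f m) i))\<^sup>2) \<le> e\<^sup>2"
      by (auto simp: eventually_sequentially)
  qed simp
  \<comment> \<open>For square-summability of the limit \<open>x\<close>, it is the difference to a term of the sequence that has bounded partial sums.\<close>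
  define L where "L = Ell2 x"
  have close: "coord L = x" "dist (f n) L \<le> e"
    if N: "\<And>m. m \<ge> N \<Longrightarrow> dist (f n) (f m) \<le> e" for n N e
  proof -
    have "0 \<le> e"
      using N[of N] zero_le_dist[of "f n" "f N"] by linarith
    define d where "d = Ell2 (\<lambda>i. coord (f n) i - x i)"
    have d: "coord d = (\<lambda>i. coord (f n) i - x i)" "norm d \<le> e"
      unfolding d_def using ell2_bounded_partial_sums[OF fin[OF N] \<open>0 \<le> e\<close>] by auto
    have "x = coord (f n - d)"
      by (auto simp: d(1))
    then have "L = f n - d"
      by (simp add: L_def coord_inverse)
    then show "coord L = x" "dist (f n) L \<le> e"
      using d \<open>x = coord (f n - d)\<close> by (auto simp: dist_norm)
  qed
  have "f \<longlonglongrightarrow> L"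
  proof (rule metric_LIMSEQ_I)
    fix r :: real assume "0 < r"
    then obtain N where N: "\<And>m n. m \<ge> N \<Longrightarrow> n \<ge> N \<Longrightarrow> dist (f m) (f n) < r / 2"
      using f by (meson Cauchy_def half_gt_zero)
    have "dist (f n) L < r" if "n \<ge> N" for n
      using close(2)[of N n "r / 2"] N[OF that] \<open>0 < r\<close> by fastforce
    then show "\<exists>N. \<forall>n\<ge>N. dist (f n) L < r"
      by blast
  qed
  then show "convergent f"
    by (rule convergentI)
qed

lift_definition unit_vec :: "'i \<Rightarrow> 'i ell2" is "\<lambda>i j. if j = i then 1 else 0"
proof -
  fix i :: 'i
  show "(\<lambda>j. (cmod (if j = i then 1 else 0))\<^sup>2) summable_on UNIV"
    by (rule summable_on_cong_neutral[where S = "{i}", THEN iffD1])  auto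
qed

section \<open>Partial translations and multiplication by the imaginary unit\<close>

text \<open>
  For \<open>h\<close> injective on \<open>A\<close>, this partial isometry sends the basis vector at \<open>h i\<close> to the one at \<open>i\<close>
  for \<open>i \<in> A\<close>, and kills the basis vectors outside \<open>h ` A\<close>. The generators of \<open>\<Q>\<^sub>2\<close>, their adjoints
  and the restrictions to sets of coordinates are all of this form.
\<close>

definition pull :: "'i set \<Rightarrow> ('i \<Rightarrow> 'j) \<Rightarrow> 'j ell2 \<Rightarrow>\<^sub>L 'i ell2" where
  "pull A h = Blinfun (\<lambda>x. Ell2 (\<lambda>i. if i \<in> A then coord x (h i) else 0))"

lemma
  assumes "inj_on h A"
  shows coord_pull: "coord (pull A h x) i = (if i \<in> A then coord x (h i) else 0)"
    and norm_pull_le: "norm (pull A h x) \<le> norm x"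
proof -
  let ?f = "\<lambda>x i. if i \<in> A then coord x (h i) else 0"
  have fin: "(\<Sum>i\<in>F. (cmod (?f x i))\<^sup>2) \<le> (norm x)\<^sup>2" if "finite F" for x F
  proof -
    have "(\<Sum>i\<in>F. (cmod (?f x i))\<^sup>2) = (\<Sum>i\<in>F \<inter> A. (cmod (coord x (h i)))\<^sup>2)"
      using that by (auto simp: sum.inter_restrict intro!: sum.cong)
    also have "\<dots> = (\<Sum>j\<in>h ` (F \<inter> A). (cmod (coord x j))\<^sup>2)"
      using inj_on_subset[OF assms] by (subst sum.reindex) auto
    also have "\<dots> \<le> (norm x)\<^sup>2"
      using that by (intro sum_coord_le) auto
    finally show ?thesis .
  qed
  note E = ell2_bounded_partial_sums[OF fin norm_ge_zero]
  have "bounded_linear (\<lambda>x. Ell2 (?f x))"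
    by (rule bounded_linear_intro[where K = 1]) (auto simp: E intro!: ell2_eqI)
  then have "blinfun_apply (pull A h) = (\<lambda>x. Ell2 (?f x))"
    by (simp add: pull_def bounded_linear_Blinfun_apply)
  then show "coord (pull A h x) i = ?f x i" "norm (pull A h x) \<le> norm x"
    using E[of x] by auto
qed

lemma inner_pull:
  assumes "bij_betw h A B" and "\<And>i. i \<in> A \<Longrightarrow> k (h i) = i"
  shows "pull A h x \<bullet> y = x \<bullet> pull B k y"
proof -
  have h: "inj_on h A" and hB: "h ` A = B"
    using assms(1) by (auto simp: bij_betw_def)
  have k: "inj_on k B"
    using assms(2) hB by (auto intro!: inj_onI)
  have "pull A h x \<bullet> y = (\<Sum>\<^sub>\<infinity>i\<in>A. coord x (h i) \<bullet> coord y i)"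
    unfolding inner_ell2_def by (rule infsum_cong_neutral) (auto simp: coord_pull[OF h])
  also have "\<dots> = (\<Sum>\<^sub>\<infinity>i\<in>A. coord x (h i) \<bullet> coord y (k (h i)))"
    by (rule infsum_cong) (simp add: assms(2))
  also have "\<dots> = (\<Sum>\<^sub>\<infinity>j\<in>B. coord x j \<bullet> coord y (k j))"
    by (rule infsum_reindex_bij_betw[OF assms(1), of "\<lambda>j. coord x j \<bullet> coord y (k j)"])
  also have "\<dots> = x \<bullet> pull B k y"
    unfolding inner_ell2_def by (rule infsum_cong_neutral) (auto simp: coord_pull[OF k])
  finally show ?thesis .
qed

definition times_i :: "'i ell2 \<Rightarrow>\<^sub>L 'i ell2" where
  "times_i = Blinfun (\<lambda>x. Ell2 (\<lambda>i. \<i> * coord x i))"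

lemma coord_times_i [simp]:
  fixes x :: "'i ell2"
  shows "coord (times_i x) i = \<i> * coord x i"
proof -
  have fin: "(\<Sum>i\<in>F. (cmod (\<i> * coord x i))\<^sup>2) \<le> (norm x)\<^sup>2" if "finite F" for F and x :: "'i ell2"
    using sum_coord_le[OF that, of x] by (simp add: norm_mult)
  note E = ell2_bounded_partial_sums[OF fin norm_ge_zero]
  have "bounded_linear (\<lambda>x :: 'i ell2. Ell2 (\<lambda>i. \<i> * coord x i))"
  proof (rule bounded_linear_intro[where K = 1])
    fix x y :: "'i ell2" and r
    show "Ell2 (\<lambda>i. \<i> * coord (x + y) i) = Ell2 (\<lambda>i. \<i> * coord x i) + Ell2 (\<lambda>i. \<i> * coord y i)"
      by (rule ell2_eqI, subst E(1)) (simp_all add: E(1) fin distrib_left)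
    show "Ell2 (\<lambda>i. \<i> * coord (r *\<^sub>R x) i) = r *\<^sub>R Ell2 (\<lambda>i. \<i> * coord x i)"
      by (rule ell2_eqI, subst E(1)) (simp_all add: E(1) fin)
    show "norm (Ell2 (\<lambda>i. \<i> * coord x i)) \<le> norm x * 1"
      by (simp add: E)
  qed
  then have "blinfun_apply times_i = (\<lambda>x :: 'i ell2. Ell2 (\<lambda>i. \<i> * coord x i))"
    by (simp add: times_i_def bounded_linear_Blinfun_apply)
  then show ?thesis
    using E(1)[of x] by simp
qed

lemma inner_times_i: "times_i x \<bullet> y = - (x \<bullet> times_i y)"
  by (simp add: inner_ell2_def inner_complex_def algebra_simps flip: infsum_uminus)


section \<open>Norm-closed *-algebras of operators are C*-algebras\<close>

text \<open>
  Adjoints are a relation first, since a bounded operator on an incomplete space may have none; \<open>adj\<close>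
  is meaningful on the algebras below, whose elements have adjoints by definition.
\<close>

definition adjoint_of :: "'h::real_inner \<Rightarrow>\<^sub>L 'h \<Rightarrow> 'h \<Rightarrow>\<^sub>L 'h \<Rightarrow> bool" where
  "adjoint_of T S \<longleftrightarrow> (\<forall>x y. T x \<bullet> y = x \<bullet> S y)"

definition adj :: "'h::real_inner \<Rightarrow>\<^sub>L 'h \<Rightarrow> 'h \<Rightarrow>\<^sub>L 'h" where
  "adj T = (THE S. adjoint_of T S)"

lemma adjoint_of_unique: "adjoint_of T S \<Longrightarrow> adjoint_of T S' \<Longrightarrow> S = S'"
  unfolding adjoint_of_def by (metis blinfun_eqI vector_eq_ldot)

lemma adj_eqI: "adjoint_of T S \<Longrightarrow> adj T = S"
  unfolding adj_def by (blast intro: the_equality adjoint_of_unique)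

lemma adjoint_of_sym: "adjoint_of T S \<Longrightarrow> adjoint_of S T"
  by (metis adjoint_of_def inner_commute)

lemma adjoint_of_add: "adjoint_of T S \<Longrightarrow> adjoint_of T' S' \<Longrightarrow> adjoint_of (T + T') (S + S')"
  by (simp add: adjoint_of_def blinfun.bilinear_simps inner_add)

lemma adjoint_of_diff: "adjoint_of T S \<Longrightarrow> adjoint_of T' S' \<Longrightarrow> adjoint_of (T - T') (S - S')"
  by (simp add: adjoint_of_def blinfun.bilinear_simps inner_diff)

lemma adjoint_of_compose:
  "adjoint_of T S \<Longrightarrow> adjoint_of T' S' \<Longrightarrow> adjoint_of (T o\<^sub>L T') (S' o\<^sub>L S)"
  by (simp add: adjoint_of_def)

lemma adjoint_of_scaleR: "adjoint_of T S \<Longrightarrow> adjoint_of (r *\<^sub>R T) (r *\<^sub>R S)"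
  by (simp add: adjoint_of_def blinfun.bilinear_simps)

lemma adjoint_of_id: "adjoint_of id_blinfun id_blinfun"
  by (simp add: adjoint_of_def)

lemma norm_adjoint_le:
  assumes "adjoint_of T S"
  shows "norm S \<le> norm T"
proof (rule norm_blinfun_bound)
  fix y
  have "norm (S y) * norm (S y) = T (S y) \<bullet> y"
    using assms by (simp add: adjoint_of_def flip: power2_norm_eq_inner power2_eq_square)
  also have "\<dots> \<le> norm (T (S y)) * norm y"
    by (rule norm_cauchy_schwarz)
  also have "\<dots> \<le> norm T * norm (S y) * norm y"
    by (intro mult_right_mono norm_blinfun) simp
  finally show "norm (S y) \<le> norm T * norm y"
    by (cases "S y = 0") (simp_all add: mult.commute mult.left_commute)
qed simp

lemma norm_adjoint: "adjoint_of T S \<Longrightarrow> norm S = norm T"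
  by (rule antisym[OF norm_adjoint_le norm_adjoint_le[OF adjoint_of_sym]])

text \<open>
  The C*-identity for operators: \<open>(norm (T x))\<^sup>2 = x \<bullet> S (T x)\<close> bounds \<open>(norm T)\<^sup>2\<close> by the norm of
  the product, and the converse estimate is submultiplicativity.
\<close>

lemma norm_adjoint_compose:
  assumes "adjoint_of T S"
  shows "norm (S o\<^sub>L T) = (norm T)\<^sup>2"
proof (rule antisym)
  show "norm (S o\<^sub>L T) \<le> (norm T)\<^sup>2"
    using norm_blinfun_compose[of S T] norm_adjoint[OF assms] by (simp add: power2_eq_square)
  have "norm T \<le> sqrt (norm (S o\<^sub>L T))"
  proof (rule norm_blinfun_bound)
    fix x
    have "(norm (T x))\<^sup>2 = x \<bullet> (S o\<^sub>L T) x"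
      using assms by (simp add: adjoint_of_def power2_norm_eq_inner)
    also have "\<dots> \<le> norm x * norm ((S o\<^sub>L T) x)"
      by (rule norm_cauchy_schwarz)
    also have "\<dots> \<le> norm x * (norm (S o\<^sub>L T) * norm x)"
      by (intro mult_left_mono norm_blinfun) simp
    also have "\<dots> = (sqrt (norm (S o\<^sub>L T)) * norm x)\<^sup>2"
      by (simp add: power_mult_distrib power2_eq_square)
    finally show "norm (T x) \<le> sqrt (norm (S o\<^sub>L T)) * norm x"
      by (rule power2_le_imp_le) simp
  qed simp
  then show "(norm T)\<^sup>2 \<le> norm (S o\<^sub>L T)"
    using power_mono[of "norm T" _ 2] by fastforce
qed

text \<open>
  This serves to show that algebras of operators with adjoints are closed: as taking adjoints is
  isometric, the adjoints of a Cauchy sequence of operators form a Cauchy sequence, too.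
\<close>

lemma adjoint_of_limit:
  assumes f: "f \<longlonglongrightarrow> T" and g: "g \<longlonglongrightarrow> S" and "\<And>n. adjoint_of (f n) (g n)"
  shows "adjoint_of T S"
  unfolding adjoint_of_def
proof (intro allI)
  fix x y
  have "(\<lambda>n. f n x \<bullet> y) \<longlonglongrightarrow> T x \<bullet> y" and "(\<lambda>n. x \<bullet> g n y) \<longlonglongrightarrow> x \<bullet> S y"
    by (intro tendsto_intros f g)+
  then show "T x \<bullet> y = x \<bullet> S y"
    using assms(3) by (simp add: adjoint_of_def LIMSEQ_unique)
qed

text \<open>
  The operator \<open>J\<close> is multiplication by \<open>\<i>\<close> on a complex Hilbert space that is seen as a real one;
  its adjoint \<open>- J\<close> is multiplication by the conjugate. Commuting with \<open>J\<close> is complex linearity.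
\<close>

locale operator_star_algebra =
  fixes J :: "'h :: {real_inner, banach} \<Rightarrow>\<^sub>L 'h" and M :: "('h \<Rightarrow>\<^sub>L 'h) set"
  assumes J_J: "J o\<^sub>L J = - id_blinfun"
    and adjoint_J: "adjoint_of J (- J)"
    and J_mem: "J \<in> M"
    and J_commute: "T \<in> M \<Longrightarrow> T o\<^sub>L J = J o\<^sub>L T"
    and id_mem: "id_blinfun \<in> M"
    and add_mem: "S \<in> M \<Longrightarrow> T \<in> M \<Longrightarrow> S + T \<in> M"
    and scaleR_mem: "T \<in> M \<Longrightarrow> r *\<^sub>R T \<in> M"
    and compose_mem: "S \<in> M \<Longrightarrow> T \<in> M \<Longrightarrow> S o\<^sub>L T \<in> M"
    and adjoint_mem: "T \<in> M \<Longrightarrow> \<exists>S\<in>M. adjoint_of T S"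
    and closed: "closed M"
begin

lemma adj_mem: "T \<in> M \<Longrightarrow> adj T \<in> M"
  and adjoint_of_adj: "T \<in> M \<Longrightarrow> adjoint_of T (adj T)"
  using adjoint_mem adj_eqI by blast+

definition scaleC :: "complex \<Rightarrow> 'h \<Rightarrow>\<^sub>L 'h \<Rightarrow> 'h \<Rightarrow>\<^sub>L 'h" where
  "scaleC c T = Re c *\<^sub>R T + Im c *\<^sub>R (J o\<^sub>L T)"

lemma J_J_apply: "J (J x) = - x"
  using arg_cong[OF J_J, of "\<lambda>T. blinfun_apply T x"] by (simp add: blinfun.bilinear_simps)

lemma J_commute_apply: "T \<in> M \<Longrightarrow> T (J x) = J (T x)"
  using arg_cong[OF J_commute[of T], of "\<lambda>T. blinfun_apply T x"] by simp

lemma scaleC_apply: "scaleC c T x = Re c *\<^sub>R T x + Im c *\<^sub>R J (T x)"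
  by (simp add: scaleC_def blinfun.bilinear_simps)

text \<open>
  Since \<open>J\<close> is isometric and \<open>J y\<close> is orthogonal to \<open>y\<close>, the vector \<open>a y + b J y\<close> has norm
  \<open>sqrt (a\<^sup>2 + b\<^sup>2)\<close> times that of \<open>y\<close>.
\<close>

lemma norm_scaleC: "norm (scaleC c T) = cmod c * norm T"
proof -
  have J: "J x \<bullet> y = - (x \<bullet> J y)" for x y
    using adjoint_J by (simp add: adjoint_of_def blinfun.bilinear_simps)
  have "(norm (scaleC c T x))\<^sup>2 = (cmod c * norm (T x))\<^sup>2" for x
  proof -
    have 1: "T x \<bullet> J (T x) = 0"
      using J[of "T x" "T x"] by (simp add: inner_commute)
    have 2: "J (T x) \<bullet> J (T x) = T x \<bullet> T x"
      by (simp add: J J_J_apply)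
    have "(norm (scaleC c T x))\<^sup>2 = (Re c)\<^sup>2 * (T x \<bullet> T x) + (Im c)\<^sup>2 * (T x \<bullet> T x)"
      unfolding power2_norm_eq_inner
      using 1 2 by (simp add: scaleC_apply inner_add
          inner_commute[of "J (T x)" "T x"] power2_eq_square)
    then show ?thesis
      by (simp add: power_mult_distrib cmod_power2 algebra_simps power2_norm_eq_inner)
  qed
  then have eq: "norm (scaleC c T x) = cmod c * norm (T x)" for x
    by (simp add: power2_eq_iff_nonneg)
  show ?thesis
  proof (rule antisym)
    show "norm (scaleC c T) \<le> cmod c * norm T"
      by (rule norm_blinfun_bound) (simp_all add: eq mult.assoc mult_left_mono norm_blinfun)
    show "cmod c * norm T \<le> norm (scaleC c T)"
    proof (cases "c = 0")
      case False
      have "norm T \<le> norm (scaleC c T) / cmod c"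
      proof (rule norm_blinfun_bound)
        fix x
        show "norm (T x) \<le> norm (scaleC c T) / cmod c * norm x"
          using norm_blinfun[of "scaleC c T" x] False by (simp add: eq field_simps)
      qed simp
      then show ?thesis
        using False by (simp add: field_simps)
    qed simp
  qed
qed

lemma scaleC_mem: "T \<in> M \<Longrightarrow> scaleC c T \<in> M"
  by (simp add: scaleC_def add_mem scaleR_mem compose_mem J_mem)

lemma zero_mem: "0 \<in> M"
  using scaleR_mem[OF id_mem, of 0] by simp

lemma adj_simps:
  assumes "S \<in> M" "T \<in> M"
  shows "adj (adj T) = T" "adj (S + T) = adj S + adj T" "adj (S o\<^sub>L T) = adj T o\<^sub>L adj S"
    "adj (scaleC c T) = scaleC (cnj c) (adj T)"
proof -
  note adj = adjoint_of_adj[OF assms(1)] adjoint_of_adj[OF assms(2)]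
  show "adj (adj T) = T"
    by (rule adj_eqI[OF adjoint_of_sym[OF adj(2)]])
  show "adj (S + T) = adj S + adj T" "adj (S o\<^sub>L T) = adj T o\<^sub>L adj S"
    by (intro adj_eqI adjoint_of_add adjoint_of_compose adj)+
  have "adjoint_of (scaleC c T) (Re c *\<^sub>R adj T + Im c *\<^sub>R (adj T o\<^sub>L (- J)))"
    unfolding scaleC_def
    by (intro adjoint_of_add adjoint_of_scaleR adjoint_of_compose adjoint_J adj)
  moreover have "Im c *\<^sub>R (adj T o\<^sub>L (- J)) = - (Im c *\<^sub>R (J o\<^sub>L adj T))"
    by (rule blinfun_eqI)
      (simp add: blinfun.bilinear_simps J_commute_apply[OF adj_mem[OF assms(2)]])
  ultimately show "adj (scaleC c T) = scaleC (cnj c) (adj T)"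
    by (simp add: adj_eqI scaleC_def)
qed

text \<open>
  The injection \<open>\<iota>\<close> renames the operators into elements of another type, because universal
  properties of C*-algebras are formulated for carriers in a fixed type.
\<close>

definition to_cstar :: "('h \<Rightarrow>\<^sub>L 'h \<Rightarrow> 'c) \<Rightarrow> 'c cstar" where
  "to_cstar \<iota> =
    \<lparr>carrier = \<iota> ` M,
     monoid.mult = (\<lambda>x y. \<iota> (inv_into UNIV \<iota> x o\<^sub>L inv_into UNIV \<iota> y)),
     one = \<iota> id_blinfun,
     ring.zero = \<iota> 0,
     add = (\<lambda>x y. \<iota> (inv_into UNIV \<iota> x + inv_into UNIV \<iota> y)),
     module.smult = (\<lambda>c x. \<iota> (scaleC c (inv_into UNIV \<iota> x))),
     star = (\<lambda>x. \<iota> (adj (inv_into UNIV \<iota> x))),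
     cnorm = (\<lambda>x. norm (inv_into UNIV \<iota> x))\<rparr>"

lemma to_cstar_simps:
  assumes "inj \<iota>"
  shows "carrier (to_cstar \<iota>) = \<iota> ` M"
    "\<iota> S \<otimes>\<^bsub>to_cstar \<iota>\<^esub> \<iota> T = \<iota> (S o\<^sub>L T)"
    "\<one>\<^bsub>to_cstar \<iota>\<^esub> = \<iota> id_blinfun"
    "\<zero>\<^bsub>to_cstar \<iota>\<^esub> = \<iota> 0"
    "\<iota> S \<oplus>\<^bsub>to_cstar \<iota>\<^esub> \<iota> T = \<iota> (S + T)"
    "c \<odot>\<^bsub>to_cstar \<iota>\<^esub> \<iota> T = \<iota> (scaleC c T)"
    "star (to_cstar \<iota>) (\<iota> T) = \<iota> (adj T)"
    "cnorm (to_cstar \<iota>) (\<iota> T) = norm T"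
  using assms by (simp_all add: to_cstar_def)

theorem cstar_algebra_to_cstar:
  fixes \<iota> :: "'h \<Rightarrow>\<^sub>L 'h \<Rightarrow> 'c"
  assumes \<iota>: "inj \<iota>"
  shows "cstar_algebra (to_cstar \<iota>)"
proof -
  let ?A = "to_cstar \<iota>"
  note simps = to_cstar_simps[OF \<iota>]
  note mem = add_mem compose_mem scaleC_mem adj_mem zero_mem id_mem
  have neg_mem: "- T \<in> M" if "T \<in> M" for T
    using scaleR_mem[OF that, of "- 1"] by simp
  have ab: "abelian_group ?A"
  proof (rule abelian_groupI)
    fix x assume "x \<in> carrier ?A"
    then obtain T where T: "T \<in> M" "x = \<iota> T"
      by (auto simp: simps)
    show "\<exists>y\<in>carrier ?A. y \<oplus>\<^bsub>?A\<^esub> x = \<zero>\<^bsub>?A\<^esub>"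
      using T neg_mem by (intro bexI[of _ "\<iota> (- T)"]) (auto simp: simps)
  qed (auto simp: simps mem algebra_simps)
  have mon: "Group.monoid ?A"
    by (rule monoidI) (auto simp: simps mem intro!: arg_cong[of _ _ \<iota>] blinfun_eqI)
  have ring: "ring ?A"
    by (intro ring.intro ab mon ring_axioms.intro)
      (auto simp: simps intro!: arg_cong[of _ _ \<iota>] blinfun_eqI simp: blinfun.bilinear_simps)
  have modul: "module (ring_of_type_algebra :: complex ring) ?A"
    by (intro module.intro cring_from_type_algebra ab module_axioms.intro)
      (auto simp: simps mem ring_of_type_algebra_def scaleC_apply blinfun.bilinear_simps J_J_apply
        algebra_simps intro!: arg_cong[of _ _ \<iota>] blinfun_eqI)
  have minus: "\<iota> S \<ominus>\<^bsub>?A\<^esub> \<iota> T = \<iota> (S - T)" if "T \<in> M" for S T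
  proof -
    interpret abelian_group ?A by (rule ab)
    have "\<ominus>\<^bsub>?A\<^esub> \<iota> T = \<iota> (- T)"
      by (rule minus_equality) (use that in \<open>auto simp: simps neg_mem\<close>)
    then show ?thesis
      by (simp add: a_minus_def simps)
  qed
  show ?thesis
  proof (intro cstar_algebra.intro modul ring cstar_algebra_axioms.intro)
    fix f :: "nat \<Rightarrow> 'c"
    assume f: "\<And>n. f n \<in> carrier ?A"
      and cau: "\<And>e. e > 0 \<Longrightarrow> \<exists>N. \<forall>m\<ge>N. \<forall>n\<ge>N. cnorm ?A (f m \<ominus>\<^bsub>?A\<^esub> f n) < e"
    have "\<forall>n. \<exists>T\<in>M. f n = \<iota> T"
      using f by (auto simp: simps)
    then obtain g where g: "\<And>n. g n \<in> M" "\<And>n. f n = \<iota> (g n)"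
      by metis
    have "Cauchy g"
      using cau by (simp add: Cauchy_def dist_norm g minus simps)
    then obtain T where T: "g \<longlonglongrightarrow> T"
      by (auto simp: Cauchy_convergent_iff convergent_def)
    have "T \<in> M"
      using closed_sequentially[OF closed _ T] g(1) by blast
    moreover have "(\<lambda>n. cnorm ?A (f n \<ominus>\<^bsub>?A\<^esub> \<iota> T)) \<longlonglongrightarrow> 0"
      using T by (simp add: g minus[OF \<open>T \<in> M\<close>] simps LIM_zero_iff tendsto_norm_zero)
    ultimately show "\<exists>x\<in>carrier ?A. (\<lambda>n. cnorm ?A (f n \<ominus>\<^bsub>?A\<^esub> x)) \<longlonglongrightarrow> 0"
      by (auto simp: simps)
  qed (auto simp: simps mem adj_simps norm_scaleC inj_eq[OF \<iota>] norm_triangle_ineq norm_blinfun_compose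
      norm_adjoint_compose[OF adjoint_of_adj] scaleC_apply blinfun.bilinear_simps J_commute_apply
      intro!: arg_cong[of _ _ \<iota>] blinfun_eqI)
qed

end

section \<open>Operators that preserve escaping sequences\<close>

definition tail :: "int \<Rightarrow> int ell2 \<Rightarrow>\<^sub>L int ell2" where
  "tail k = pull {k..} id"

lemma coord_tail: "coord (tail k x) i = (if k \<le> i then coord x i else 0)"
  by (simp add: tail_def coord_pull)

lemma norm_tail_le: "norm (tail k x) \<le> norm x"
  by (simp add: tail_def norm_pull_le)

definition escaping :: "(nat \<Rightarrow> int ell2) \<Rightarrow> bool" where
  "escaping v \<longleftrightarrow> Bseq v \<and> (\<forall>k. (\<lambda>n. tail k (v n)) \<longlonglongrightarrow> 0)"

text \<open>
  Mapping escaping sequences to escaping sequences is a property that composes by its very form,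
  unlike the decay of matrix entries that it serves to prove.
\<close>

definition preserves_escaping :: "(int ell2 \<Rightarrow>\<^sub>L int ell2) \<Rightarrow> bool" where
  "preserves_escaping T \<longleftrightarrow> (\<forall>v. escaping v \<longrightarrow> escaping (\<lambda>n. T (v n)))"

lemma Bseq_blinfun:
  fixes T :: "'a :: real_normed_vector \<Rightarrow>\<^sub>L 'b :: real_normed_vector"
  shows "Bseq v \<Longrightarrow> Bseq (\<lambda>n. T (v n))"
  using bounded_linear_image[OF _ blinfun.bounded_linear_right, of "range v" T]
  by (simp add: Bseq_eq_bounded image_image)

lemma preserves_escaping_id: "preserves_escaping id_blinfun"
  by (simp add: preserves_escaping_def)

lemma preserves_escaping_compose:
  "preserves_escaping S \<Longrightarrow> preserves_escaping T \<Longrightarrow> preserves_escaping (S o\<^sub>L T)"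
  by (simp add: preserves_escaping_def)

lemma preserves_escaping_add:
  assumes "preserves_escaping S" "preserves_escaping T"
  shows "preserves_escaping (S + T)"
  unfolding preserves_escaping_def escaping_def
proof (intro allI impI conjI)
  fix v k assume v: "Bseq v \<and> (\<forall>k. (\<lambda>n. tail k (v n)) \<longlonglongrightarrow> 0)"
  then show "Bseq (\<lambda>n. (S + T) (v n))"
    by (simp add: Bseq_blinfun)
  have "(\<lambda>n. tail k (S (v n)) + tail k (T (v n))) \<longlonglongrightarrow> 0 + 0"
    using assms v by (intro tendsto_add) (auto simp: preserves_escaping_def escaping_def)
  then show "(\<lambda>n. tail k ((S + T) (v n))) \<longlonglongrightarrow> 0"
    by (simp add: blinfun.bilinear_simps)
qed

lemma preserves_escaping_scaleR:
  assumes "preserves_escaping T"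
  shows "preserves_escaping (r *\<^sub>R T)"
  unfolding preserves_escaping_def escaping_def
proof (intro allI impI conjI)
  fix v k assume v: "Bseq v \<and> (\<forall>k. (\<lambda>n. tail k (v n)) \<longlonglongrightarrow> 0)"
  then show "Bseq (\<lambda>n. (r *\<^sub>R T) (v n))"
    by (simp add: Bseq_blinfun)
  have "(\<lambda>n. r *\<^sub>R tail k (T (v n))) \<longlonglongrightarrow> r *\<^sub>R 0"
    using assms v by (intro tendsto_scaleR tendsto_const) (auto simp: preserves_escaping_def escaping_def)
  then show "(\<lambda>n. tail k ((r *\<^sub>R T) (v n))) \<longlonglongrightarrow> 0"
    by (simp add: blinfun.bilinear_simps)
qed

text \<open>
  The criterion through which the concrete operators enter: if what \<open>T x\<close> has from \<open>k\<close> on is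
  controlled by what \<open>x\<close> has from some \<open>k'\<close> on, then mass that has left every right half-line
  cannot return.
\<close>

lemma preserves_escaping_dominated:
  fixes T :: "int ell2 \<Rightarrow>\<^sub>L int ell2"
  assumes "\<And>k. \<exists>k'. \<forall>x. norm (tail k (T x)) \<le> norm (tail k' x)"
  shows "preserves_escaping T"
  unfolding preserves_escaping_def escaping_def
proof (intro allI impI conjI)
  fix v k assume v: "Bseq v \<and> (\<forall>k. (\<lambda>n. tail k (v n)) \<longlonglongrightarrow> 0)"
  then show "Bseq (\<lambda>n. T (v n))"
    by (simp add: Bseq_blinfun)
  obtain k' where k': "\<And>x. norm (tail k (T x)) \<le> norm (tail k' x)"
    using assms by blast
  have "(\<lambda>n. norm (tail k' (v n))) \<longlonglongrightarrow> 0"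
    using v tendsto_norm_zero by blast
  then show "(\<lambda>n. tail k (T (v n))) \<longlonglongrightarrow> 0"
    by (rule Lim_null_comparison[rotated]) (simp add: k')
qed

lemma preserves_escaping_times_i: "preserves_escaping times_i"
proof (rule preserves_escaping_dominated)
  fix k
  have "tail k (times_i x) = times_i (tail k x)" for x
    by (rule ell2_eqI) (simp add: coord_tail)
  moreover have "norm (times_i x) = norm x" for x :: "int ell2"
    by (rule power2_eq_imp_eq) (simp_all add: norm_ell2_power2 norm_mult)
  ultimately have "norm (tail k (times_i x)) \<le> norm (tail k x)" for x
    by simp
  then show "\<exists>k'. \<forall>x. norm (tail k (times_i x)) \<le> norm (tail k' x)"
    by blast
qed

text \<open>
  Here the positive slope enters: \<open>h\<close> is bounded below on every part of \<open>A\<close> that is bounded below.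
  The reflection \<open>h i = - i\<close> of the integers fails this.
\<close>

lemma preserves_escaping_pull:
  assumes h: "inj_on h A" and lower: "\<And>k. \<exists>k'. \<forall>i\<in>A. k \<le> i \<longrightarrow> k' \<le> h i"
  shows "preserves_escaping (pull A h)"
proof (rule preserves_escaping_dominated)
  fix k
  obtain k' where k': "\<And>i. i \<in> A \<Longrightarrow> k \<le> i \<Longrightarrow> k' \<le> h i"
    using lower by blast
  have inj: "inj_on h (A \<inter> {k..})"
    using h by (rule inj_on_subset) simp
  have "tail k (pull A h x) = pull (A \<inter> {k..}) h (tail k' x)" for x
    by (rule ell2_eqI) (auto simp: coord_tail coord_pull h inj k')
  then show "\<exists>k'. \<forall>x. norm (tail k (pull A h x)) \<le> norm (tail k' x)"
    using norm_pull_le[OF inj] by metis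
qed

text \<open>
  The usual interchange of limits: an escaping sequence is bounded, so the error of replacing \<open>T\<close>
  by a nearby \<open>f m\<close> is uniform along the sequence.
\<close>

lemma preserves_escaping_limit:
  assumes f: "f \<longlonglongrightarrow> T" and pres: "\<And>m. preserves_escaping (f m)"
  shows "preserves_escaping T"
  unfolding preserves_escaping_def escaping_def
proof (intro allI impI conjI)
  fix v k assume v: "Bseq v \<and> (\<forall>k. (\<lambda>n. tail k (v n)) \<longlonglongrightarrow> 0)"
  then show "Bseq (\<lambda>n. T (v n))"
    by (simp add: Bseq_blinfun)
  obtain b where b: "b > 0" "\<And>n. norm (v n) \<le> b"
    using v by (auto elim: BseqE)
  show "(\<lambda>n. tail k (T (v n))) \<longlonglongrightarrow> 0"
  proof (rule LIMSEQ_I)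
    fix e :: real assume "0 < e"
    then obtain m where m: "norm (T - f m) < e / (2 * b)"
      using LIMSEQ_D[OF f, of "e / (2 * b)"] b(1) by (auto simp: norm_minus_commute)
    have "(\<lambda>n. tail k (f m (v n))) \<longlonglongrightarrow> 0"
      using pres[of m] v by (auto simp: preserves_escaping_def escaping_def)
    then obtain N where N: "\<And>n. n \<ge> N \<Longrightarrow> norm (tail k (f m (v n))) < e / 2"
      using LIMSEQ_D[of _ 0 "e / 2"] \<open>0 < e\<close> by fastforce
    have "norm (tail k (T (v n)) - 0) < e" if "n \<ge> N" for n
    proof -
      have "norm (tail k ((T - f m) (v n))) \<le> norm (T - f m) * norm (v n)"
        using norm_tail_le norm_blinfun order_trans by blast
      also have "\<dots> \<le> e / (2 * b) * b"
        using m b \<open>0 < e\<close> by (intro mult_mono) auto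
      finally have "norm (tail k ((T - f m) (v n))) \<le> e / 2"
        using b(1) by simp
      moreover have "tail k (T (v n)) = tail k ((T - f m) (v n)) + tail k (f m (v n))"
        by (simp add: blinfun.bilinear_simps)
      ultimately show ?thesis
        using N[OF that] norm_triangle_ineq[of "tail k ((T - f m) (v n))" "tail k (f m (v n))"]
        by simp
    qed
    then show "\<exists>N. \<forall>n\<ge>N. norm (tail k (T (v n)) - 0) < e"
      by blast
  qed
qed

text \<open>
  The basis vectors are translates of each other, which bounds their norms uniformly.
\<close>

lemma escaping_unit_vec: "escaping (\<lambda>n. unit_vec (- int n))"
  unfolding escaping_def
proof (intro conjI allI)
  have "norm (unit_vec (- int n)) \<le> norm (unit_vec 0 :: int ell2)" for n
  proof -
    have "unit_vec (- int n) = pull UNIV (\<lambda>i. i + int n) (unit_vec 0)"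
      by (rule ell2_eqI) (auto simp: coord_pull unit_vec.rep_eq)
    then show ?thesis
      by (simp add: norm_pull_le)
  qed
  then show "Bseq (\<lambda>n. unit_vec (- int n))"
    by (rule BseqI')
  fix k
  have "tail k (unit_vec (- int n)) = 0" if "n \<ge> nat (1 - k)" for n
    using that by (intro ell2_eqI) (auto simp: coord_tail unit_vec.rep_eq)
  then show "(\<lambda>n. tail k (unit_vec (- int n))) \<longlonglongrightarrow> 0"
    by (intro tendsto_eventually) (auto simp: eventually_sequentially)
qed

definition directed_operators :: "(int ell2 \<Rightarrow>\<^sub>L int ell2) set" where
  "directed_operators =
    {T. T o\<^sub>L times_i = times_i o\<^sub>L T \<and> preserves_escaping T \<and>
        (\<exists>S. adjoint_of T S \<and> preserves_escaping S)}"

text \<open>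
  Take adjoints on both sides of the hypothesis and use their uniqueness; the adjoint of
  multiplication by \<open>\<i>\<close> is its negative.
\<close>

lemma adjoint_commute_times_i:
  assumes "adjoint_of T S" and "T o\<^sub>L times_i = times_i o\<^sub>L T"
  shows "S o\<^sub>L times_i = times_i o\<^sub>L S"
proof -
  have i: "adjoint_of times_i (- times_i)"
    by (simp add: adjoint_of_def inner_times_i blinfun.bilinear_simps)
  have "(- times_i) o\<^sub>L S = S o\<^sub>L (- times_i)"
    using adjoint_of_compose[OF assms(1) i] adjoint_of_compose[OF i assms(1)] assms(2)
    by (metis adjoint_of_unique)
  then have "(- times_i) (S x) = S ((- times_i) x)" for x
    by (metis blinfun_apply_blinfun_compose)
  then show ?thesis
    by (intro blinfun_eqI) (simp add: blinfun.bilinear_simps)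
qed

interpretation directed: operator_star_algebra times_i directed_operators
proof
  show "times_i o\<^sub>L times_i = - (id_blinfun :: int ell2 \<Rightarrow>\<^sub>L int ell2)"
    by (intro blinfun_eqI ell2_eqI) (simp add: blinfun.bilinear_simps flip: mult.assoc)
  show adj_i: "adjoint_of times_i (- times_i :: int ell2 \<Rightarrow>\<^sub>L int ell2)"
    by (simp add: adjoint_of_def inner_times_i blinfun.bilinear_simps)
  have "preserves_escaping (- times_i)"
    using preserves_escaping_scaleR[OF preserves_escaping_times_i, of "- 1"] by simp
  then show "times_i \<in> directed_operators"
    using adj_i preserves_escaping_times_i by (auto simp: directed_operators_def)
  show "id_blinfun \<in> directed_operators"
    using adjoint_of_id preserves_escaping_id
    by (auto simp: directed_operators_def intro!: blinfun_eqI)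
next
  fix T assume "T \<in> directed_operators"
  then show "T o\<^sub>L times_i = times_i o\<^sub>L T"
    by (simp add: directed_operators_def)
next
  fix S T assume ST: "S \<in> directed_operators" "T \<in> directed_operators"
  then have comm: "S (times_i x) = times_i (S x)" "T (times_i x) = times_i (T x)" for x
    by (auto simp: directed_operators_def) (metis blinfun_apply_blinfun_compose)+
  show "S + T \<in> directed_operators"
    using ST adjoint_of_add preserves_escaping_add unfolding directed_operators_def
    by (auto intro!: blinfun_eqI simp: comm blinfun.bilinear_simps) blast
  show "S o\<^sub>L T \<in> directed_operators"
    using ST adjoint_of_compose preserves_escaping_compose unfolding directed_operators_def
    by (auto intro!: blinfun_eqI simp: comm) blast
  fix r
  show "r *\<^sub>R T \<in> directed_operators"
    using ST(2) adjoint_of_scaleR preserves_escaping_scaleR unfolding directed_operators_def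
    by (auto intro!: blinfun_eqI simp: comm blinfun.bilinear_simps) blast
  show "\<exists>S\<in>directed_operators. adjoint_of T S"
    using ST(2) adjoint_commute_times_i adjoint_of_sym unfolding directed_operators_def by blast
next
  show "closed directed_operators"
    unfolding closed_sequential_limits
  proof (intro allI impI, elim conjE)
    fix f T assume mem: "\<forall>n. f n \<in> directed_operators" and T: "f \<longlonglongrightarrow> T"
    then have "\<forall>n. \<exists>S. adjoint_of (f n) S \<and> preserves_escaping S"
      by (auto simp: directed_operators_def)
    then obtain g where g: "\<And>n. adjoint_of (f n) (g n)" "\<And>n. preserves_escaping (g n)"
      by metis
    have "dist (g m) (g n) = dist (f m) (f n)" for m n
      unfolding dist_norm by (rule norm_adjoint[OF adjoint_of_diff]) (rule g)+
    then have "Cauchy g"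
      using LIMSEQ_imp_Cauchy[OF T] by (simp add: Cauchy_def)
    then obtain S where S: "g \<longlonglongrightarrow> S"
      by (auto simp: Cauchy_convergent_iff convergent_def)
    have "(\<lambda>n. f n o\<^sub>L times_i) \<longlonglongrightarrow> (T o\<^sub>L times_i)"
        "(\<lambda>n. times_i o\<^sub>L f n) \<longlonglongrightarrow> (times_i o\<^sub>L T)"
      by (intro tendsto_intros T)+
    then have "T o\<^sub>L times_i = times_i o\<^sub>L T"
      using mem by (simp add: directed_operators_def LIMSEQ_unique)
    moreover have "preserves_escaping T" "preserves_escaping S"
      using preserves_escaping_limit[OF T] preserves_escaping_limit[OF S] mem g(2)
      by (auto simp: directed_operators_def)
    ultimately show "T \<in> directed_operators"
      using adjoint_of_limit[OF T S g(1)] by (auto simp: directed_operators_def)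
  qed
qed

lemma pull_directed:
  assumes bij: "bij_betw h A B" and inv: "\<And>i. i \<in> A \<Longrightarrow> k (h i) = i"
    and "\<And>c. \<exists>d. \<forall>i\<in>A. c \<le> i \<longrightarrow> d \<le> h i" and "\<And>c. \<exists>d. \<forall>j\<in>B. c \<le> j \<longrightarrow> d \<le> k j"
  shows "pull A h \<in> directed_operators" and "adjoint_of (pull A h) (pull B k)"
proof -
  have h: "inj_on h A" and k: "inj_on k B"
    using bij inv by (auto simp: bij_betw_def intro!: inj_onI)
  show adj: "adjoint_of (pull A h) (pull B k)"
    using inner_pull[OF bij inv] by (simp add: adjoint_of_def)
  have "pull A h o\<^sub>L times_i = times_i o\<^sub>L pull A h"
    by (intro blinfun_eqI ell2_eqI) (simp add: coord_pull h)
  then show "pull A h \<in> directed_operators"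
    using adj preserves_escaping_pull[OF h assms(3)] preserves_escaping_pull[OF k assms(4)]
    by (auto simp: directed_operators_def)
qed

section \<open>The canonical representation and the absence of reflections\<close>

text \<open>
  The generators act by \<open>shift 1\<close> and \<open>dilation\<close>, that is, \<open>e\<^sub>k \<mapsto> e\<^sub>k\<^sub>+\<^sub>1\<close> and \<open>e\<^sub>k \<mapsto> e\<^sub>2\<^sub>k\<close>. The adjoint
  \<open>decimation\<close> of the latter sends \<open>e\<^sub>2\<^sub>k\<close> to \<open>e\<^sub>k\<close> and kills the odd basis vectors.
\<close>

definition shift :: "int \<Rightarrow> int ell2 \<Rightarrow>\<^sub>L int ell2" where
  "shift k = pull UNIV (\<lambda>i. i - k)"

definition dilation :: "int ell2 \<Rightarrow>\<^sub>L int ell2" where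
  "dilation = pull (Collect even) (\<lambda>i. i div 2)"

definition decimation :: "int ell2 \<Rightarrow>\<^sub>L int ell2" where
  "decimation = pull UNIV (\<lambda>i. 2 * i)"

lemma inj_on_div_2: "inj_on (\<lambda>i :: int. i div 2) (Collect even)"
  by (auto simp: inj_on_def elim!: evenE)

lemma coord_representation [simp]:
  "coord (shift k x) i = coord x (i - k)"
  "coord (dilation x) i = (if even i then coord x (i div 2) else 0)"
  "coord (decimation x) i = coord x (2 * i)"
  by (simp_all add: shift_def dilation_def decimation_def coord_pull[OF inj_on_div_2]
      coord_pull[OF inj_on_def[THEN iffD2]])

lemma shift_directed:
  shows "shift k \<in> directed_operators" and "adjoint_of (shift k) (shift (- k))"
proof -
  have bij: "bij_betw (\<lambda>i. i - k) UNIV UNIV"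
    by (rule bij_betwI[where g = "\<lambda>i. i + k"]) auto
  have lower: "\<exists>d. \<forall>i\<in>UNIV. c \<le> i \<longrightarrow> d \<le> i - k" for c k :: int
    by (rule exI[of _ "c - k"]) auto
  have "i - k - (- k) = i" for i
    by simp
  note directed = pull_directed[OF bij this lower lower]
  show "shift k \<in> directed_operators"
    unfolding shift_def by (rule directed(1))
  show "adjoint_of (shift k) (shift (- k))"
    unfolding shift_def by (rule directed(2))
qed

lemma dilation_directed:
  shows "dilation \<in> directed_operators" and "adjoint_of dilation decimation"
proof -
  have bij: "bij_betw (\<lambda>i :: int. i div 2) (Collect even) UNIV"
    by (rule bij_betwI[where g = "\<lambda>i. 2 * i"]) auto
  have inv: "2 * (i div 2) = i" if "i \<in> Collect even" for i :: int
    using that by simp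
  have lower: "\<exists>d. \<forall>i\<in>Collect even. c \<le> i \<longrightarrow> d \<le> i div 2" for c :: int
    by (rule exI[of _ "c div 2"]) (simp add: zdiv_mono1)
  have lower': "\<exists>d. \<forall>i\<in>UNIV. c \<le> i \<longrightarrow> d \<le> 2 * i" for c :: int
    by (rule exI[of _ "2 * c"]) simp
  note directed = pull_directed[OF bij inv lower lower']
  show "dilation \<in> directed_operators"
    unfolding dilation_def by (rule directed(1))
  show "adjoint_of dilation decimation"
    unfolding dilation_def decimation_def by (rule directed(2))
qed

text \<open>
  The relation makes the matrix of \<open>W\<close> constant along antidiagonals (\<open>hankel\<close>). Moving along an
  antidiagonal, the column index goes to minus infinity while the row index grows, and there
  the matrix entries of an operator preserving escaping sequences tend to \<open>0\<close>.
\<close>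

lemma preserves_escaping_no_reflection:
  assumes W: "preserves_escaping W" and refl: "W o\<^sub>L shift 1 = shift (- 1) o\<^sub>L W"
  shows "W (unit_vec 0) = 0"
proof (rule ell2_eqI)
  fix d
  have hankel: "coord (W (unit_vec (- int n))) (d + int n) = coord (W (unit_vec 0)) d" for n
  proof (induction n)
    case (Suc n)
    have "unit_vec (- int n) = shift 1 (unit_vec (- int (Suc n)))"
      by (rule ell2_eqI) (auto simp: unit_vec.rep_eq)
    then have "W (unit_vec (- int n)) = shift (- 1) (W (unit_vec (- int (Suc n))))"
      using refl by (metis blinfun_apply_blinfun_compose)
    then show ?case
      using Suc.IH by (simp add: algebra_simps)
  qed simp
  have "(\<lambda>n. tail d (W (unit_vec (- int n)))) \<longlonglongrightarrow> 0"
    using W escaping_unit_vec by (auto simp: preserves_escaping_def escaping_def)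
  moreover have "cmod (coord (W (unit_vec 0)) d) \<le> norm (tail d (W (unit_vec (- int n))))" for n
    using coord_le_norm[of "tail d (W (unit_vec (- int n)))" "d + int n"]
    by (simp add: coord_tail hankel)
  ultimately have "cmod (coord (W (unit_vec 0)) d) \<le> 0"
    by (intro LIMSEQ_le_const[OF tendsto_norm_zero]) auto
  then show "coord (W (unit_vec 0)) d = coord 0 d"
    by simp
qed

section \<open>The test algebra and the theorem\<close>

text \<open>
  Outside the square-summable functions, \<open>Ell2\<close> has unspecified values. This is harmless for
  injectivity, as an operator is recovered from the values on square-summable functions.
\<close>

definition encode :: "(int ell2 \<Rightarrow>\<^sub>L int ell2) \<Rightarrow> test_carrier" where
  "encode T = (\<lambda>x. coord (T (Ell2 x)))"

lemma inj_encode: "inj encode"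
proof (rule injI)
  fix S T assume eq: "encode S = encode T"
  have "coord (S x) = coord (T x)" for x
    using fun_cong[OF eq, of "coord x"] by (simp add: encode_def coord_inverse)
  then show "S = T"
    by (intro blinfun_eqI) (simp add: coord_inject)
qed

definition test_algebra :: "test_carrier cstar" where
  "test_algebra = directed.to_cstar encode"

lemmas test_algebra_simps = directed.to_cstar_simps[OF inj_encode, folded test_algebra_def]

lemma cstar_algebra_test_algebra: "cstar_algebra test_algebra"
  unfolding test_algebra_def by (rule directed.cstar_algebra_to_cstar[OF inj_encode])

lemma Q2_relations_test_algebra: "Q2_relations test_algebra (encode (shift 1)) (encode dilation)"
proof -
  interpret cstar_algebra test_algebra
    by (rule cstar_algebra_test_algebra)
  have adj: "adj (shift 1) = shift (- 1)" "adj dilation = decimation"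
    by (intro adj_eqI shift_directed dilation_directed)+
  note simps = test_algebra_simps adj
  have mem: "encode (shift 1) \<in> carrier test_algebra" "encode dilation \<in> carrier test_algebra"
    using shift_directed dilation_directed by (auto simp: simps)
  have id_o: "id_blinfun o\<^sub>L T = T" for T :: "int ell2 \<Rightarrow>\<^sub>L int ell2"
    by (rule blinfun_eqI) simp
  have "encode (shift 1) [^]\<^bsub>test_algebra\<^esub> (2 :: nat) = encode (shift 1 o\<^sub>L shift 1)"
    using mem by (simp add: numeral_2_eq_2 simps id_o)
  moreover have "dilation o\<^sub>L shift 1 = (shift 1 o\<^sub>L shift 1) o\<^sub>L dilation"
    by (intro blinfun_eqI ell2_eqI) (auto elim!: evenE)
  \<comment> \<open>The two summands are the projections onto the even and onto the odd coordinates.\<close>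
  moreover have "(dilation o\<^sub>L decimation)
      + (((shift 1 o\<^sub>L dilation) o\<^sub>L decimation) o\<^sub>L shift (- 1)) = id_blinfun"
    by (intro blinfun_eqI ell2_eqI) (auto simp: blinfun.bilinear_simps elim!: evenE oddE)
  moreover have "shift (- 1) o\<^sub>L shift 1 = id_blinfun" "shift 1 o\<^sub>L shift (- 1) = id_blinfun"
      "decimation o\<^sub>L dilation = id_blinfun"
    by (intro blinfun_eqI ell2_eqI; simp)+
  ultimately show ?thesis
    using mem by (simp add: Q2_relations_def unitary_in_def isometry_in_def simps)
qed

lemma no_unitary_reflects_shift:
  assumes "unitary_in test_algebra w"
  shows "w \<otimes>\<^bsub>test_algebra\<^esub> encode (shift 1) \<noteq> star test_algebra (encode (shift 1)) \<otimes>\<^bsub>test_algebra\<^esub> w"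
proof
  assume eq: "w \<otimes>\<^bsub>test_algebra\<^esub> encode (shift 1) = star test_algebra (encode (shift 1)) \<otimes>\<^bsub>test_algebra\<^esub> w"
  obtain W where W: "W \<in> directed_operators" "w = encode W"
    using assms by (auto simp: unitary_in_def test_algebra_simps)
  have "W o\<^sub>L shift 1 = shift (- 1) o\<^sub>L W"
    using eq by (simp add: W test_algebra_simps adj_eqI[OF shift_directed(2)] inj_eq[OF inj_encode])
  then have "W (unit_vec 0) = 0"
    using W(1) by (intro preserves_escaping_no_reflection) (auto simp: directed_operators_def)
  moreover have "adj W o\<^sub>L W = id_blinfun"
    using assms by (simp add: unitary_in_def W test_algebra_simps inj_eq[OF inj_encode])
  ultimately have "unit_vec 0 = (0 :: int ell2)"
    by (metis blinfun.zero_right blinfun_apply_blinfun_compose blinfun_apply_id_blinfun)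
  then have "coord (unit_vec (0 :: int)) 0 = 0"
    by simp
  then show False
    by (simp add: unit_vec.rep_eq)
qed

theorem theorem5p9:
  fixes A :: "'a cstar" and U S\<^sub>2 :: 'a and \<alpha> :: "'a \<Rightarrow> 'a"
  assumes "is_Q2 A U S\<^sub>2"
    and "star_automorphism A \<alpha>"
    and "\<alpha> U = star A U"
  shows "outer_automorphism A \<alpha>"
proof -
  have "\<not> inner_automorphism A \<alpha>"
  proof
    assume "inner_automorphism A \<alpha>"
    then obtain w where w: "unitary_in A w"
      and \<alpha>: "\<And>x. x \<in> carrier A \<Longrightarrow> \<alpha> x = w \<otimes>\<^bsub>A\<^esub> x \<otimes>\<^bsub>A\<^esub> star A w"
      by (auto simp: inner_automorphism_def)
    interpret cstar_algebra A
      using assms(1) by (simp add: is_Q2_def)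
    have U: "U \<in> carrier A"
      using assms(1) by (simp add: is_Q2_def Q2_relations_def unitary_in_def)
    have w_mem: "w \<in> carrier A" and w_star: "star A w \<otimes>\<^bsub>A\<^esub> w = \<one>\<^bsub>A\<^esub>" "w \<otimes>\<^bsub>A\<^esub> star A w = \<one>\<^bsub>A\<^esub>"
      using w by (auto simp: unitary_in_def)
    have "star A U \<otimes>\<^bsub>A\<^esub> w = w \<otimes>\<^bsub>A\<^esub> U \<otimes>\<^bsub>A\<^esub> star A w \<otimes>\<^bsub>A\<^esub> w"
      using \<alpha>[OF U] assms(3) by simp
    also have "\<dots> = w \<otimes>\<^bsub>A\<^esub> U"
      using U w_mem by (simp add: m_assoc star_closed w_star)
    finally have eq: "star A U \<otimes>\<^bsub>A\<^esub> w = w \<otimes>\<^bsub>A\<^esub> U" .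
    obtain \<phi> where \<phi>: "star_hom A test_algebra \<phi>" "\<phi> U = encode (shift 1)"
      using assms(1) cstar_algebra_test_algebra Q2_relations_test_algebra
      unfolding is_Q2_def by blast
    then have hom: "\<phi> \<in> ring_hom A test_algebra"
      and star_\<phi>: "\<And>x. x \<in> carrier A \<Longrightarrow> \<phi> (star A x) = star test_algebra (\<phi> x)"
      by (auto simp: star_hom_def)
    have "unitary_in test_algebra (\<phi> w)"
      using ring_hom_mult[OF hom star_closed[OF w_mem] w_mem]
        ring_hom_mult[OF hom w_mem star_closed[OF w_mem]]
      by (simp add: unitary_in_def ring_hom_closed[OF hom w_mem] w_star star_\<phi> w_mem ring_hom_one[OF hom])
    moreover have "\<phi> w \<otimes>\<^bsub>test_algebra\<^esub> encode (shift 1)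
        = star test_algebra (encode (shift 1)) \<otimes>\<^bsub>test_algebra\<^esub> \<phi> w"
      using ring_hom_mult[OF hom w_mem U] ring_hom_mult[OF hom star_closed[OF U] w_mem]
      by (simp add: eq star_\<phi> U \<phi>(2))
    ultimately show False
      using no_unitary_reflects_shift by blast
  qed
  with assms(2) show ?thesis
    by (simp add: outer_automorphism_def)
qed

end
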